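(* For $i=1,2$, let $(E_i,\tau_i)$ be a locally solid Riesz space. Suppose that at least one of the following four conditions holds: (a) $(E_1,\tau_1)$ has a countable neighborhood base at zero; (b) for each $i=1,2$, $(E_i,\tau_i)$ has a $\tau_i$-bounded convex neighborhood of zero; (c) for each $i=1,2$, $(E_i,\tau_i)$ is a locally convex Hausdorff space; (d) $(E_1,\tau_1)$ is bornological and $(E_2,\tau_2)$ is locally convex. Then: (i) If for each $i=1,2$ the space $(E_i,\tau_i)$ has an order bounded $\tau_i$-neighborhood of zero and $E_2$ is also Dedekind complete, then $\mathcal{L}_{b}(E_1,E_2)=\mathcal{L}_r(E_1,E_2)=\mathcal{L}_{tb}(E_1,E_2)=\mathcal{L}_{tc}(E_1,E_2)$. (ii) If for each $i=1,2$ the positive cone $E_i^+$ has nonempty $\tau_i$-interior, then $\mathcal{L}_{b}(E_1,E_2)=\mathcal{L}_{tb}(E_1,E_2)=\mathcal{L}_{tc}(E_1,E_2)$. (iii) If the hypothesis of (ii) holds and $E_2$ is also Dedekind complete, then $\mathcal{L}_{b}(E_1,E_2)=\mathcal{L}_r(E_1,E_2)=\mathcal{L}_{tb}(E_1,E_2)=\mathcal{L}_{tc}(E_1,E_2)$.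
   Context: A Riesz space is a real vector lattice $E$, with positive cone $E^+=\{x\in E: x\ge 0\}$. A locally solid Riesz space $(E,\tau)$ is a Riesz space with a linear (vector space) topology $\tau$, not assumed Hausdorff, having a base of neighborhoods of zero consisting of solid sets ($A$ is solid if $|x|\le|y|$ and $y\in A$ imply $x\in A$). A subset is order bounded if it is contained in some order interval $[x,y]=\{z: x\le z\le y\}$; it is $\tau$-bounded (topologically bounded) if it is absorbed by every $\tau$-neighborhood of zero. $E$ is Dedekind complete if every nonempty subset that is bounded above has a supremum. A bornological space is a locally convex space in which every convex circled (balanced) set that absorbs all topologically bounded sets is a neighborhood of zero; equivalently, a locally convex space such that every topologically bounded linear operator from it to a locally convex space is continuous. Operators are linear maps $T:E_1\to E_2$. $\mathcal{L}_b(E_1,E_2)$ is the space of order bounded operators (mapping order bounded sets to order bounded sets); $\mathcal{L}_r(E_1,E_2)$ is the space of regular operators (differences of two positive operators, where $T$ is positive if $T(E_1^+)\subset E_2^+$); $\mathcal{L}_{tb}(E_1,E_2)$ is the space of topologically bounded operators (mapping $\tau_1$-bounded sets to $\tau_2$-bounded sets); $\mathcal{L}_{tc}(E_1,E_2)$ is the space of topologically continuous operators (continuous from $\tau_1$ to $\tau_2$). *)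

theory Defs
  imports "HOL-Analysis.Analysis" "HOL-Library.Lattice_Algebras"
begin

(* The modulus belongs to the class signature and is fixed by the class axiom abs_lattice:
   \<bar>x\<bar> = sup x (- x). *)
class riesz_space = ordered_real_vector + lattice_ab_group_add_abs

instance real :: riesz_space ..

definition dedekind_complete :: "'a::order itself \<Rightarrow> bool" where
  "dedekind_complete _ \<longleftrightarrow>
     (\<forall>A::'a set. A \<noteq> {} \<and> bdd_above A \<longrightarrow>
        (\<exists>s. (\<forall>a\<in>A. a \<le> s) \<and> (\<forall>u. (\<forall>a\<in>A. a \<le> u) \<longrightarrow> s \<le> u)))"

definition solid :: "'a::riesz_space set \<Rightarrow> bool" where
  "solid A \<longleftrightarrow> (\<forall>x y. \<bar>x\<bar> \<le> \<bar>y\<bar> \<and> y \<in> A \<longrightarrow> x \<in> A)"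

definition order_bounded :: "'a::riesz_space set \<Rightarrow> bool" where
  "order_bounded A \<longleftrightarrow> (\<exists>x y. A \<subseteq> {x..y})"

definition balanced :: "'a::real_vector set \<Rightarrow> bool" where
  "balanced A \<longleftrightarrow> (\<forall>c. \<forall>x\<in>A. \<bar>c\<bar> \<le> 1 \<longrightarrow> c *\<^sub>R x \<in> A)"

definition absorbs :: "'a::real_vector set \<Rightarrow> 'a set \<Rightarrow> bool" where
  "absorbs A B \<longleftrightarrow> (\<exists>r>0. \<forall>c. r \<le> \<bar>c\<bar> \<longrightarrow> B \<subseteq> (*\<^sub>R) c ` A)"

(* Topologies are explicit values of type 'a topology, not type class instances;
   they are not assumed to be Hausdorff. *)
definition linear_topology :: "'a::real_vector topology \<Rightarrow> bool" where
  "linear_topology \<tau> \<longleftrightarrow>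
     topspace \<tau> = UNIV \<and>
     continuous_map (prod_topology \<tau> \<tau>) \<tau> (\<lambda>(x, y). x + y) \<and>
     continuous_map (prod_topology euclideanreal \<tau>) \<tau> (\<lambda>(c, x). c *\<^sub>R x)"

(* Neighborhoods of zero need not be open. *)
definition zero_nhd :: "'a::real_vector topology \<Rightarrow> 'a set \<Rightarrow> bool" where
  "zero_nhd \<tau> N \<longleftrightarrow> (\<exists>U. openin \<tau> U \<and> 0 \<in> U \<and> U \<subseteq> N)"

definition countable_zero_base :: "'a::real_vector topology \<Rightarrow> bool" where
  "countable_zero_base \<tau> \<longleftrightarrow>
     (\<exists>\<B>. countable \<B> \<and> (\<forall>V\<in>\<B>. zero_nhd \<tau> V) \<and>
          (\<forall>N. zero_nhd \<tau> N \<longrightarrow> (\<exists>V\<in>\<B>. V \<subseteq> N)))"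

definition topologically_bounded :: "'a::real_vector topology \<Rightarrow> 'a set \<Rightarrow> bool" where
  "topologically_bounded \<tau> B \<longleftrightarrow> (\<forall>N. zero_nhd \<tau> N \<longrightarrow> absorbs N B)"

definition locally_solid :: "'a::riesz_space topology \<Rightarrow> bool" where
  "locally_solid \<tau> \<longleftrightarrow> linear_topology \<tau> \<and> neighbourhood_base_at 0 solid \<tau>"

definition locally_convex :: "'a::real_vector topology \<Rightarrow> bool" where
  "locally_convex \<tau> \<longleftrightarrow> linear_topology \<tau> \<and> neighbourhood_base_at 0 convex \<tau>"

definition bornological :: "'a::real_vector topology \<Rightarrow> bool" where
  "bornological \<tau> \<longleftrightarrow>
     locally_convex \<tau> \<and>
     (\<forall>A. convex A \<and> balanced A \<and> (\<forall>B. topologically_bounded \<tau> B \<longrightarrow> absorbs A B)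
          \<longrightarrow> zero_nhd \<tau> A)"

definition positive_operator :: "('a::riesz_space \<Rightarrow> 'b::riesz_space) \<Rightarrow> bool" where
  "positive_operator T \<longleftrightarrow> linear T \<and> (\<forall>x\<ge>0. T x \<ge> 0)"

definition L_b :: "('a::riesz_space \<Rightarrow> 'b::riesz_space) set" where
  "L_b = {T. linear T \<and> (\<forall>A. order_bounded A \<longrightarrow> order_bounded (T ` A))}"

definition L_r :: "('a::riesz_space \<Rightarrow> 'b::riesz_space) set" where
  "L_r = {T. \<exists>P Q. positive_operator P \<and> positive_operator Q \<and> T = (\<lambda>x. P x - Q x)}"

definition L_tb ::
  "'a::real_vector topology \<Rightarrow> 'b::real_vector topology \<Rightarrow> ('a \<Rightarrow> 'b) set" where
  "L_tb \<tau>\<^sub>1 \<tau>\<^sub>2 =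
     {T. linear T \<and>
         (\<forall>A. topologically_bounded \<tau>\<^sub>1 A \<longrightarrow> topologically_bounded \<tau>\<^sub>2 (T ` A))}"

definition L_tc ::
  "'a::real_vector topology \<Rightarrow> 'b::real_vector topology \<Rightarrow> ('a \<Rightarrow> 'b) set" where
  "L_tc \<tau>\<^sub>1 \<tau>\<^sub>2 = {T. linear T \<and> continuous_map \<tau>\<^sub>1 \<tau>\<^sub>2 T}"

end

theory Submission
  imports Defs
begin

text \<open>
  Each of the three parts has hypotheses that make some order interval \<open>[-u, u]\<close> a neighbourhood
  of zero in each space: a solid neighbourhood \<open>V\<close> with \<open>u + V\<close> inside the positive cone
  satisfies \<open>\<bar>v\<bar> \<le> u\<close> for all \<open>v \<in> V\<close>, and an order bounded neighbourhood lies in some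
  \<open>[-u, u]\<close> anyway. In a locally solid space order bounded sets are topologically bounded, because
  solid neighbourhoods absorb whole intervals as soon as they absorb the end points; and a set
  absorbed by \<open>[-u, u]\<close> is order bounded. So both notions of boundedness coincide, and with
  them the order bounded and the topologically bounded operators. Moreover \<open>[-u, u]\<close> is then a
  topologically bounded neighbourhood of zero, and a linear map that sends one such neighbourhood
  to a bounded set is continuous; conversely, continuous linear maps always preserve boundedness.

  When the codomain is Dedekind complete, order bounded operators are regular by the theorem of
  Riesz and Kantorovich: the positive part of \<open>T\<close> at \<open>x \<ge> 0\<close> is the supremum of \<open>T y\<close> over
  \<open>0 \<le> y \<le> x\<close>. It is additive on the cone by the Riesz decomposition property, extends linearly
  to the whole space, and dominates \<open>T\<close>.
\<close>

section \<open>Zero neighbourhoods in linear and locally solid topologies\<close>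

lemma continuous_map_translation:
  assumes "linear_topology \<tau>"
  shows "continuous_map \<tau> \<tau> ((+) a)"
proof -
  have "continuous_map \<tau> (prod_topology \<tau> \<tau>) (\<lambda>x. (a, x))"
    using assms by (auto simp: linear_topology_def continuous_map_pairwise o_def)
  then have "continuous_map \<tau> \<tau> ((\<lambda>(x, y). x + y) \<circ> (\<lambda>x. (a, x)))"
    using assms unfolding linear_topology_def by (blast intro: continuous_map_compose)
  then show ?thesis
    by (simp add: o_def)
qed

lemma continuous_map_dilation:
  assumes "linear_topology \<tau>"
  shows "continuous_map \<tau> \<tau> ((*\<^sub>R) c)"
proof -
  have "continuous_map \<tau> (prod_topology euclideanreal \<tau>) (\<lambda>x. (c, x))"
    using assms by (auto simp: linear_topology_def continuous_map_pairwise o_def)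
  then have "continuous_map \<tau> \<tau> ((\<lambda>(c, x). c *\<^sub>R x) \<circ> (\<lambda>x. (c, x)))"
    using assms unfolding linear_topology_def by (blast intro: continuous_map_compose)
  then show ?thesis
    by (simp add: o_def)
qed

lemma continuous_map_scale_vector:
  assumes "linear_topology \<tau>"
  shows "continuous_map euclideanreal \<tau> (\<lambda>c. c *\<^sub>R x)"
proof -
  have "continuous_map euclideanreal (prod_topology euclideanreal \<tau>) (\<lambda>c. (c, x))"
    using assms by (auto simp: linear_topology_def continuous_map_pairwise o_def)
  then have "continuous_map euclideanreal \<tau> ((\<lambda>(c, x). c *\<^sub>R x) \<circ> (\<lambda>c. (c, x)))"
    using assms unfolding linear_topology_def by (blast intro: continuous_map_compose)
  then show ?thesis
    by (simp add: o_def)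
qed

lemma openin_vimage_UNIV:
  assumes "continuous_map \<sigma> \<tau> f" "topspace \<sigma> = UNIV" "openin \<tau> U"
  shows "openin \<sigma> (f -` U)"
  using openin_continuous_map_preimage[OF assms(1,3)] assms(2) by (simp add: vimage_def)

lemma zero_nhd_vimage:
  assumes "continuous_map \<sigma> \<tau> f" "topspace \<sigma> = UNIV" "f 0 = 0" "zero_nhd \<tau> N"
  shows "zero_nhd \<sigma> (f -` N)"
proof -
  obtain U where U: "openin \<tau> U" "0 \<in> U" "U \<subseteq> N"
    using assms(4) unfolding zero_nhd_def by blast
  then have "openin \<sigma> (f -` U)" "0 \<in> f -` U" "f -` U \<subseteq> f -` N"
    using openin_vimage_UNIV[OF assms(1,2)] assms(3) by auto
  then show ?thesis
    unfolding zero_nhd_def by blast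
qed

lemma zero_nhd_mono: "zero_nhd \<tau> M \<Longrightarrow> M \<subseteq> N \<Longrightarrow> zero_nhd \<tau> N"
  unfolding zero_nhd_def by blast

lemma zero_nhd_absorbs_vector:
  assumes "linear_topology \<tau>" "zero_nhd \<tau> N"
  obtains r where "r > 0" "\<And>c. r \<le> \<bar>c\<bar> \<Longrightarrow> inverse c *\<^sub>R x \<in> N"
proof -
  obtain U where U: "openin \<tau> U" "0 \<in> U" "U \<subseteq> N"
    using assms(2) unfolding zero_nhd_def by blast
  have "open ((\<lambda>c. c *\<^sub>R x) -` U)"
    using openin_vimage_UNIV[OF continuous_map_scale_vector[OF assms(1)] _ U(1)] by simp
  moreover have "0 \<in> (\<lambda>c. c *\<^sub>R x) -` U"
    using U by simp
  ultimately obtain e where e: "e > 0" "ball 0 e \<subseteq> (\<lambda>c. c *\<^sub>R x) -` U"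
    unfolding open_contains_ball by blast
  show thesis
  proof
    show "2 / e > 0"
      using e by simp
    fix c :: real
    assume c: "2 / e \<le> \<bar>c\<bar>"
    moreover have "1 / e < 2 / e"
      using e by (simp add: divide_strict_right_mono)
    ultimately have "1 / e < \<bar>c\<bar>"
      by linarith
    moreover have "0 < 1 / e"
      using e by simp
    ultimately have "inverse \<bar>c\<bar> < inverse (1 / e)"
      by (rule less_imp_inverse_less)
    then have "inverse c \<in> ball 0 e"
      by simp
    then show "inverse c *\<^sub>R x \<in> N"
      using e U by blast
  qed
qed

lemma solid_zero_nhd_below:
  assumes "locally_solid \<tau>" "zero_nhd \<tau> N"
  obtains V where "zero_nhd \<tau> V" "solid V" "V \<subseteq> N"
proof -
  obtain W where "openin \<tau> W" "0 \<in> W" "W \<subseteq> N"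
    using assms(2) unfolding zero_nhd_def by blast
  moreover have "neighbourhood_base_at 0 solid \<tau>"
    using assms(1) by (simp add: locally_solid_def)
  ultimately obtain U V where "openin \<tau> U" "solid V" "0 \<in> U" "U \<subseteq> V" "V \<subseteq> W"
    unfolding neighbourhood_base_at_def by meson
  then show thesis
    using \<open>W \<subseteq> N\<close> that[of V] unfolding zero_nhd_def by blast
qed

section \<open>Topological boundedness and order boundedness\<close>

lemma order_bounded_iff_symmetric:
  "order_bounded A \<longleftrightarrow> (\<exists>u. A \<subseteq> {- u..u})"
proof
  assume "order_bounded A"
  then obtain x y where "A \<subseteq> {x..y}"
    unfolding order_bounded_def by blast
  moreover have "{x..y} \<subseteq> {- sup (- x) y..sup (- x) y}"
    by (auto simp: minus_le_iff intro: le_supI1 le_supI2)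
  ultimately show "\<exists>u. A \<subseteq> {- u..u}"
    by blast
qed (auto simp: order_bounded_def)

text \<open>
  This is what lets a solid set absorb \<open>[-u, u]\<close> as soon as it absorbs the single vector \<open>u\<close>.
\<close>
lemma abs_scaleR_le_interval:
  fixes z u :: "'a::riesz_space"
  assumes "z \<in> {- u..u}"
  shows "\<bar>d *\<^sub>R z\<bar> \<le> \<bar>d *\<^sub>R u\<bar>"
proof -
  have "z \<le> u" "- z \<le> u"
    using assms by (auto simp: minus_le_iff)
  then have *: "\<bar>d\<bar> *\<^sub>R z \<le> \<bar>d\<bar> *\<^sub>R u" "\<bar>d\<bar> *\<^sub>R (- z) \<le> \<bar>d\<bar> *\<^sub>R u"
    by (simp_all only: scaleR_left_mono abs_ge_zero)
  have "\<bar>d *\<^sub>R z\<bar> \<le> \<bar>d\<bar> *\<^sub>R u"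
    using * by (cases "d \<ge> 0") (auto intro: abs_leI)
  also have "\<dots> \<le> \<bar>d *\<^sub>R u\<bar>"
    by (cases "d \<ge> 0") (auto intro: abs_ge_self abs_ge_minus_self)
  finally show ?thesis .
qed

lemma absorbsI_inverse:
  assumes "r > 0" "\<And>c x. r \<le> \<bar>c\<bar> \<Longrightarrow> x \<in> B \<Longrightarrow> inverse c *\<^sub>R x \<in> A"
  shows "absorbs A B"
  unfolding absorbs_def
proof (intro exI conjI allI impI subsetI)
  fix c x
  assume "r \<le> \<bar>c\<bar>" "x \<in> B"
  then have "inverse c *\<^sub>R x \<in> A" "x = c *\<^sub>R (inverse c *\<^sub>R x)"
    using assms by auto
  then show "x \<in> (*\<^sub>R) c ` A"
    by blast
qed (use assms in simp)

lemma order_bounded_imp_topologically_bounded: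
  assumes "locally_solid \<tau>" "order_bounded B"
  shows "topologically_bounded \<tau> B"
  unfolding topologically_bounded_def
proof (intro allI impI)
  fix N
  assume "zero_nhd \<tau> N"
  then obtain V where V: "zero_nhd \<tau> V" "solid V" "V \<subseteq> N"
    using solid_zero_nhd_below[OF assms(1)] by blast
  obtain u where u: "B \<subseteq> {- u..u}"
    using assms(2) order_bounded_iff_symmetric by blast
  obtain r where r: "r > 0" "\<And>c. r \<le> \<bar>c\<bar> \<Longrightarrow> inverse c *\<^sub>R u \<in> V"
    using zero_nhd_absorbs_vector[OF _ V(1)] assms(1) unfolding locally_solid_def by blast
  show "absorbs N B"
  proof (rule absorbsI_inverse[OF r(1)])
    fix c x
    assume "r \<le> \<bar>c\<bar>" "x \<in> B"
    then have "inverse c *\<^sub>R u \<in> V" "\<bar>inverse c *\<^sub>R x\<bar> \<le> \<bar>inverse c *\<^sub>R u\<bar>"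
      using r u abs_scaleR_le_interval by blast+
    then show "inverse c *\<^sub>R x \<in> N"
      using V unfolding solid_def by blast
  qed
qed

lemma topologically_bounded_imp_order_bounded:
  assumes "zero_nhd \<tau> {- u..u}" "topologically_bounded \<tau> B"
  shows "order_bounded B"
proof -
  obtain r where r: "r > 0" "\<And>c. r \<le> \<bar>c\<bar> \<Longrightarrow> B \<subseteq> (*\<^sub>R) c ` {- u..u}"
    using assms unfolding topologically_bounded_def absorbs_def by meson
  then have "B \<subseteq> (*\<^sub>R) r ` {- u..u}"
    by simp
  moreover have "(*\<^sub>R) r ` {- u..u} \<subseteq> {r *\<^sub>R (- u)..r *\<^sub>R u}"
    using r(1) by (auto simp del: scaleR_minus_right intro!: scaleR_left_mono)
  ultimately show ?thesis
    unfolding order_bounded_def by blast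
qed

lemma topologically_bounded_iff_order_bounded:
  assumes "locally_solid \<tau>" "zero_nhd \<tau> {- u..u}"
  shows "topologically_bounded \<tau> B \<longleftrightarrow> order_bounded B"
  using assms order_bounded_imp_topologically_bounded topologically_bounded_imp_order_bounded
  by blast

lemma interval_zero_nhd_of_order_bounded:
  assumes "zero_nhd \<tau> V" "order_bounded V"
  shows "\<exists>u. zero_nhd \<tau> {- u..u}"
  using assms zero_nhd_mono unfolding order_bounded_iff_symmetric by blast

text \<open>
  Solidity turns the one-sided information \<open>u + v \<ge> 0\<close> for \<open>v\<close> in a neighbourhood into the
  two-sided bound \<open>\<bar>v\<bar> \<le> u\<close>, since \<open>- \<bar>v\<bar>\<close> lies in every solid set containing \<open>v\<close>.
\<close>
lemma interval_zero_nhd_of_cone_interior: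
  assumes "locally_solid \<tau>" "\<tau> interior_of {x. 0 \<le> x} \<noteq> {}"
  shows "\<exists>u. zero_nhd \<tau> {- u..u}"
proof -
  have lin: "linear_topology \<tau>"
    using assms(1) by (simp add: locally_solid_def)
  obtain u W where W: "openin \<tau> W" "u \<in> W" "W \<subseteq> {x. 0 \<le> x}"
    using assms(2) unfolding interior_of_def by blast
  have "openin \<tau> ((+) u -` W)"
    using openin_vimage_UNIV[OF continuous_map_translation[OF lin] _ W(1)] lin
    by (simp add: linear_topology_def)
  then have "zero_nhd \<tau> ((+) u -` W)"
    using W(2) unfolding zero_nhd_def by (metis add_0_right order_refl vimageI)
  then obtain V where V: "zero_nhd \<tau> V" "solid V" "V \<subseteq> (+) u -` W"
    using solid_zero_nhd_below[OF assms(1)] by blast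
  have "V \<subseteq> {- u..u}"
  proof
    fix v
    assume "v \<in> V"
    then have "- \<bar>v\<bar> \<in> V"
      using V(2) unfolding solid_def by (metis abs_idempotent abs_minus_cancel order_refl)
    then have "\<bar>v\<bar> \<le> u"
      using V(3) W(3) by fastforce
    then show "v \<in> {- u..u}"
      by (metis abs_le_D1 abs_le_D2 atLeastAtMost_iff minus_le_iff)
  qed
  then show ?thesis
    using V(1) zero_nhd_mono by blast
qed

section \<open>Bounded and continuous operators\<close>

lemma L_b_eq_L_tb:
  fixes \<tau>\<^sub>1 :: "'a::riesz_space topology" and \<tau>\<^sub>2 :: "'b::riesz_space topology"
  assumes "locally_solid \<tau>\<^sub>1" "locally_solid \<tau>\<^sub>2"
    and "zero_nhd \<tau>\<^sub>1 {- u..u}" "zero_nhd \<tau>\<^sub>2 {- v..v}"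
  shows "L_b = L_tb \<tau>\<^sub>1 \<tau>\<^sub>2"
  unfolding L_b_def L_tb_def
  using topologically_bounded_iff_order_bounded[OF assms(1,3)]
    topologically_bounded_iff_order_bounded[OF assms(2,4)] by simp

lemma L_tc_subset_L_tb:
  assumes "linear_topology \<tau>\<^sub>1"
  shows "L_tc \<tau>\<^sub>1 \<tau>\<^sub>2 \<subseteq> L_tb \<tau>\<^sub>1 \<tau>\<^sub>2"
proof
  fix T
  assume "T \<in> L_tc \<tau>\<^sub>1 \<tau>\<^sub>2"
  then have T: "linear T" "continuous_map \<tau>\<^sub>1 \<tau>\<^sub>2 T"
    by (auto simp: L_tc_def)
  have "absorbs N (T ` A)" if A: "topologically_bounded \<tau>\<^sub>1 A" and N: "zero_nhd \<tau>\<^sub>2 N" for A N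
  proof -
    have "zero_nhd \<tau>\<^sub>1 (T -` N)"
      using zero_nhd_vimage[OF T(2) _ _ N] assms linear_0[OF T(1)]
      by (simp add: linear_topology_def)
    then obtain r where r: "r > 0" "\<And>c. r \<le> \<bar>c\<bar> \<Longrightarrow> A \<subseteq> (*\<^sub>R) c ` (T -` N)"
      using A unfolding topologically_bounded_def absorbs_def by meson
    have "T ` A \<subseteq> (*\<^sub>R) c ` N" if "r \<le> \<bar>c\<bar>" for c
      using r(2)[OF that] by (force simp: linear_scale[OF T(1)])
    then show ?thesis
      unfolding absorbs_def using r(1) by blast
  qed
  then show "T \<in> L_tb \<tau>\<^sub>1 \<tau>\<^sub>2"
    using T(1) by (simp add: L_tb_def topologically_bounded_def)
qed

lemma linear_continuous_map_if_at_zero: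
  assumes lin: "linear_topology \<tau>\<^sub>1" "linear_topology \<tau>\<^sub>2" "linear T"
    and zero: "\<And>N. zero_nhd \<tau>\<^sub>2 N \<Longrightarrow> zero_nhd \<tau>\<^sub>1 (T -` N)"
  shows "continuous_map \<tau>\<^sub>1 \<tau>\<^sub>2 T"
proof -
  have sp: "topspace \<tau>\<^sub>1 = UNIV" "topspace \<tau>\<^sub>2 = UNIV"
    using lin by (auto simp: linear_topology_def)
  have "\<exists>W. openin \<tau>\<^sub>1 W \<and> x \<in> W \<and> W \<subseteq> T -` U" if U: "openin \<tau>\<^sub>2 U" "T x \<in> U" for U x
  proof -
    have "openin \<tau>\<^sub>2 ((+) (T x) -` U)"
      by (rule openin_vimage_UNIV[OF continuous_map_translation[OF lin(2)] sp(2) U(1)])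
    then have "zero_nhd \<tau>\<^sub>2 ((+) (T x) -` U)"
      using U(2) unfolding zero_nhd_def by (metis add_0_right order_refl vimageI)
    then obtain W where W: "openin \<tau>\<^sub>1 W" "0 \<in> W" "W \<subseteq> T -` ((+) (T x) -` U)"
      using zero unfolding zero_nhd_def by meson
    have "openin \<tau>\<^sub>1 ((+) (- x) -` W)"
      by (rule openin_vimage_UNIV[OF continuous_map_translation[OF lin(1)] sp(1) W(1)])
    moreover have "x \<in> (+) (- x) -` W"
      using W(2) by simp
    moreover have "T y \<in> U" if "- x + y \<in> W" for y
    proof -
      have "T x + T (- x + y) \<in> U"
        using W(3) that by auto
      then show ?thesis
        using lin(3) by (simp add: linear_add[symmetric])
    qed
    ultimately show ?thesis
      by (intro exI[of _ "(+) (- x) -` W"]) auto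
  qed
  then have "openin \<tau>\<^sub>1 (T -` U)" if "openin \<tau>\<^sub>2 U" for U
    using that by (subst openin_subopen) blast
  then show ?thesis
    using sp by (simp add: continuous_map_def vimage_def)
qed

text \<open>
  If \<open>T B \<subseteq> r N\<close>, then \<open>T\<close> maps the shrunken neighbourhood \<open>B / r\<close> into \<open>N\<close>; so one bounded
  neighbourhood \<open>B\<close>, whose image is absorbed by every \<open>N\<close>, suffices for continuity at zero.
\<close>
lemma L_tb_subset_L_tc:
  assumes lin: "linear_topology \<tau>\<^sub>1" "linear_topology \<tau>\<^sub>2"
    and B: "zero_nhd \<tau>\<^sub>1 B" "topologically_bounded \<tau>\<^sub>1 B"
  shows "L_tb \<tau>\<^sub>1 \<tau>\<^sub>2 \<subseteq> L_tc \<tau>\<^sub>1 \<tau>\<^sub>2"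
proof
  fix T
  assume "T \<in> L_tb \<tau>\<^sub>1 \<tau>\<^sub>2"
  then have T: "linear T" "topologically_bounded \<tau>\<^sub>2 (T ` B)"
    using B(2) by (auto simp: L_tb_def)
  have "zero_nhd \<tau>\<^sub>1 (T -` N)" if N: "zero_nhd \<tau>\<^sub>2 N" for N
  proof -
    obtain r where r: "r > 0" "\<And>c. r \<le> \<bar>c\<bar> \<Longrightarrow> T ` B \<subseteq> (*\<^sub>R) c ` N"
      using T(2) N unfolding topologically_bounded_def absorbs_def by meson
    then have TB: "T ` B \<subseteq> (*\<^sub>R) r ` N"
      by simp
    have "T x \<in> N" if x: "r *\<^sub>R x \<in> B" for x
    proof -
      obtain y where "y \<in> N" "T (r *\<^sub>R x) = r *\<^sub>R y"
        using TB x by blast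
      then show ?thesis
        using r(1) by (simp add: linear_scale[OF T(1)])
    qed
    then have "(*\<^sub>R) r -` B \<subseteq> T -` N"
      by blast
    moreover have "zero_nhd \<tau>\<^sub>1 ((*\<^sub>R) r -` B)"
      using zero_nhd_vimage[OF continuous_map_dilation[OF lin(1)] _ _ B(1)] lin(1)
      by (simp add: linear_topology_def)
    ultimately show ?thesis
      by (rule zero_nhd_mono[rotated])
  qed
  then show "T \<in> L_tc \<tau>\<^sub>1 \<tau>\<^sub>2"
    using linear_continuous_map_if_at_zero[OF lin T(1)] T(1) by (simp add: L_tc_def)
qed

lemma L_tb_eq_L_tc:
  assumes "locally_solid \<tau>\<^sub>1" "locally_solid \<tau>\<^sub>2" "zero_nhd \<tau>\<^sub>1 {- u..u}"
  shows "L_tb \<tau>\<^sub>1 \<tau>\<^sub>2 = L_tc \<tau>\<^sub>1 \<tau>\<^sub>2"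
proof -
  have "topologically_bounded \<tau>\<^sub>1 {- u..u}"
    using order_bounded_imp_topologically_bounded[OF assms(1)] by (auto simp: order_bounded_def)
  then show ?thesis
    using assms L_tb_subset_L_tc L_tc_subset_L_tb unfolding locally_solid_def by blast
qed

section \<open>Regular operators and the Riesz-Kantorovich theorem\<close>

lemma positive_operator_mono:
  assumes "positive_operator P" "x \<le> y"
  shows "P x \<le> P y"
proof -
  have "0 \<le> P (y - x)"
    using assms by (simp add: positive_operator_def)
  then show ?thesis
    using assms(1) by (simp add: positive_operator_def linear_diff)
qed

lemma L_r_subset_L_b: "L_r \<subseteq> L_b"
proof
  fix T :: "'a \<Rightarrow> 'b"
  assume "T \<in> L_r"
  then obtain P Q where PQ: "positive_operator P" "positive_operator Q" "T = (\<lambda>x. P x - Q x)"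
    unfolding L_r_def by blast
  have "linear T"
    unfolding PQ(3) using PQ(1,2) by (intro linear_compose_sub) (auto simp: positive_operator_def)
  moreover have "order_bounded (T ` A)" if A: "order_bounded A" for A
  proof -
    obtain x y where "A \<subseteq> {x..y}"
      using A unfolding order_bounded_def by blast
    moreover have "T z \<in> {P x - Q y..P y - Q x}" if "z \<in> {x..y}" for z
      using that unfolding PQ(3) by (auto intro!: diff_mono PQ(1,2)[THEN positive_operator_mono])
    ultimately have "T ` A \<subseteq> {P x - Q y..P y - Q x}"
      by blast
    then show ?thesis
      unfolding order_bounded_def by blast
  qed
  ultimately show "T \<in> L_b"
    by (simp add: L_b_def)
qed

text \<open>
  The value at \<open>x\<close> has to be \<open>p (x\<^sup>+) - p (x\<^sup>-)\<close>. Additivity of \<open>p\<close> makes this difference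
  independent of the way \<open>x\<close> is written as a difference of positive elements, and that
  independence yields linearity.
\<close>
lemma linear_extension_from_cone:
  fixes p :: "'a::riesz_space \<Rightarrow> 'b::riesz_space"
  assumes add: "\<And>x y. 0 \<le> x \<Longrightarrow> 0 \<le> y \<Longrightarrow> p (x + y) = p x + p y"
    and scale: "\<And>c x. 0 \<le> c \<Longrightarrow> 0 \<le> x \<Longrightarrow> p (c *\<^sub>R x) = c *\<^sub>R p x"
  obtains P where "linear P" "\<And>x. 0 \<le> x \<Longrightarrow> P x = p x"
proof -
  define P where "P x = p (sup x 0) - p (sup (- x) 0)" for x
  have decomp: "x = sup x 0 - sup (- x) 0" for x :: 'a
  proof -
    have "nprt x = - sup (- x) 0"
      by (simp only: nprt_def inf_eq_neg_sup minus_zero)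
    then have "sup x 0 - sup (- x) 0 = pprt x + nprt x"
      by (simp only: pprt_def diff_conv_add_uminus)
    then show ?thesis
      by (simp only: prts[symmetric])
  qed
  have P: "P (a - b) = p a - p b" if ab: "0 \<le> a" "0 \<le> b" for a b
  proof -
    define u where "u = sup (a - b) 0"
    define v where "v = sup (- (a - b)) 0"
    have "a - b = u - v"
      unfolding u_def v_def by (rule decomp)
    then have "u + b = a + v"
      by (simp add: algebra_simps)
    moreover have "0 \<le> u" "0 \<le> v"
      unfolding u_def v_def by (rule sup_ge2)+
    ultimately have "p u + p b = p a + p v"
      using add[of u b] add[of a v] ab by simp
    then show ?thesis
      unfolding P_def u_def[symmetric] v_def[symmetric] by (simp add: algebra_simps)
  qed
  have p0: "p 0 = 0"
    using scale[of 0 0] by simp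
  have "linear P"
  proof (rule linearI)
    fix x y :: 'a and c :: real
    define a where "a = sup x 0"
    define b where "b = sup (- x) 0"
    define a' where "a' = sup y 0"
    define b' where "b' = sup (- y) 0"
    note defs = a_def b_def a'_def b'_def
    have nn: "0 \<le> a" "0 \<le> b" "0 \<le> a'" "0 \<le> b'"
      by (simp_all add: defs)
    have xy: "x = a - b" "y = a' - b'"
      unfolding defs by (rule decomp)+
    have Pxy: "P x = p a - p b" "P y = p a' - p b'"
      using nn P unfolding xy by blast+
    have "x + y = (a + a') - (b + b')"
      by (simp add: xy)
    then have "P (x + y) = p (a + a') - p (b + b')"
      using nn P[of "a + a'" "b + b'"] by simp
    then show "P (x + y) = P x + P y"
      using nn by (simp add: Pxy add)
    show "P (c *\<^sub>R x) = c *\<^sub>R P x"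
    proof (cases "0 \<le> c")
      case True
      have "c *\<^sub>R x = c *\<^sub>R a - c *\<^sub>R b"
        by (simp add: xy scaleR_diff_right)
      moreover have "0 \<le> c *\<^sub>R a" "0 \<le> c *\<^sub>R b"
        using True nn by (auto intro: scaleR_nonneg_nonneg)
      ultimately have "P (c *\<^sub>R x) = p (c *\<^sub>R a) - p (c *\<^sub>R b)"
        using P by simp
      then show ?thesis
        using True nn by (simp add: Pxy scale scaleR_diff_right)
    next
      case False
      have "c *\<^sub>R x = (- c) *\<^sub>R b - (- c) *\<^sub>R a"
        by (simp add: xy scaleR_diff_right)
      moreover have "0 \<le> (- c) *\<^sub>R a" "0 \<le> (- c) *\<^sub>R b"
        using False nn scaleR_nonneg_nonneg[of "- c"] by auto
      ultimately have "P (c *\<^sub>R x) = p ((- c) *\<^sub>R b) - p ((- c) *\<^sub>R a)"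
        using P by (simp del: scaleR_minus_left)
      also have "\<dots> = (- c) *\<^sub>R p b - (- c) *\<^sub>R p a"
        using False nn scale[of "- c" a] scale[of "- c" b] by simp
      finally show ?thesis
        by (simp add: Pxy scaleR_diff_right)
    qed
  qed
  moreover have "P x = p x" if "0 \<le> x" for x
    using P[OF that order_refl] p0 by simp
  ultimately show thesis
    by (rule that)
qed

lemma riesz_decomposition:
  fixes x y z :: "'a::riesz_space"
  assumes "0 \<le> x" "0 \<le> y" "0 \<le> z" "z \<le> x + y"
  obtains a b where "0 \<le> a" "a \<le> x" "0 \<le> b" "b \<le> y" "z = a + b"
proof
  show "0 \<le> inf z x" "inf z x \<le> x" "z = inf z x + (z - inf z x)"
    using assms by (simp_all only: le_inf_iff inf_le2 add_diff_cancel_left' add_diff_eq simp_thms)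
  show "0 \<le> z - inf z x"
    by (simp only: diff_ge_0_iff_ge inf_le1)
  have "z - y \<le> inf z x"
    using assms by (auto simp: algebra_simps)
  then show "z - inf z x \<le> y"
    by (simp only: diff_le_eq add.commute)
qed

text \<open>
  The positive part is built from \<open>p x = sup {T y | 0 \<le> y \<le> x}\<close>, which exists because the
  interval \<open>[0, x]\<close> has an order bounded image. Riesz decomposition splits each element below
  \<open>x + y\<close> and gives \<open>p (x + y) \<le> p x + p y\<close>; the converse holds because elements below \<open>x\<close>
  and below \<open>y\<close> add up to an element below \<open>x + y\<close>. Homogeneity
  comes from scaling the intervals.
\<close>
theorem riesz_kantorovich_L_b_subset_L_r:
  assumes "dedekind_complete TYPE('b)"
  shows "(L_b :: ('a::riesz_space \<Rightarrow> 'b::riesz_space) set) \<subseteq> L_r"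
proof
  fix T :: "'a \<Rightarrow> 'b"
  assume "T \<in> L_b"
  then have T: "linear T" "\<And>A. order_bounded A \<Longrightarrow> order_bounded (T ` A)"
    by (auto simp: L_b_def)
  have "\<exists>s. 0 \<le> x \<longrightarrow> (\<forall>y. 0 \<le> y \<and> y \<le> x \<longrightarrow> T y \<le> s) \<and>
      (\<forall>t. (\<forall>y. 0 \<le> y \<and> y \<le> x \<longrightarrow> T y \<le> t) \<longrightarrow> s \<le> t)" for x
  proof (cases "0 \<le> x")
    case True
    have "order_bounded {0..x}"
      by (auto simp: order_bounded_def)
    then obtain l h where "T ` {0..x} \<subseteq> {l..h}"
      using T(2)[of "{0..x}"] unfolding order_bounded_def by blast
    then have "bdd_above (T ` {0..x})"
      by (meson bdd_above_Icc bdd_above_mono)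
    moreover have "T ` {0..x} \<noteq> {}"
      using True by simp
    ultimately obtain s where "\<forall>a\<in>T ` {0..x}. a \<le> s"
      "\<forall>t. (\<forall>a\<in>T ` {0..x}. a \<le> t) \<longrightarrow> s \<le> t"
      using assms unfolding dedekind_complete_def by meson
    then show ?thesis
      by (intro exI[of _ s]) simp
  qed simp
  then obtain p where p: "\<And>x. 0 \<le> x \<longrightarrow> (\<forall>y. 0 \<le> y \<and> y \<le> x \<longrightarrow> T y \<le> p x) \<and>
      (\<forall>t. (\<forall>y. 0 \<le> y \<and> y \<le> x \<longrightarrow> T y \<le> t) \<longrightarrow> p x \<le> t)"
    by metis
  have upper: "T y \<le> p x" if "0 \<le> y" "y \<le> x" for x y
    using p[of x] that order_trans[OF that] by blast
  have least: "p x \<le> t" if "0 \<le> x" "\<And>y. 0 \<le> y \<Longrightarrow> y \<le> x \<Longrightarrow> T y \<le> t" for x t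
    using p[of x] that by blast
  have add: "p (x + y) = p x + p y" if xy: "0 \<le> x" "0 \<le> y" for x y
  proof (rule order.antisym)
    show "p (x + y) \<le> p x + p y"
    proof (rule least)
      fix z
      assume "0 \<le> z" "z \<le> x + y"
      then obtain a b where ab: "0 \<le> a" "a \<le> x" "0 \<le> b" "b \<le> y" "z = a + b"
        using riesz_decomposition[OF xy] by blast
      then have "T z = T a + T b"
        using T(1) by (simp add: linear_add)
      then show "T z \<le> p x + p y"
        using ab by (simp add: add_mono upper)
    qed (use xy in simp)
    have "p y \<le> p (x + y) - T a" if a: "0 \<le> a" "a \<le> x" for a
    proof (rule least[OF xy(2)])
      fix b
      assume b: "0 \<le> b" "b \<le> y"
      have "T (a + b) \<le> p (x + y)"
        using a b by (intro upper) (auto intro: add_mono)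
      then show "T b \<le> p (x + y) - T a"
        using T(1) by (simp add: linear_add algebra_simps)
    qed
    then have "p x \<le> p (x + y) - p y"
      by (intro least[OF xy(1)]) (simp add: algebra_simps)
    then show "p x + p y \<le> p (x + y)"
      by (simp add: algebra_simps)
  qed
  have scale_le: "p (c *\<^sub>R x) \<le> c *\<^sub>R p x" if c: "0 < c" and x: "0 \<le> x" for c x
  proof (rule least)
    show "0 \<le> c *\<^sub>R x"
      using c x by (simp add: scaleR_nonneg_nonneg)
    fix y
    assume y: "0 \<le> y" "y \<le> c *\<^sub>R x"
    have "inverse c *\<^sub>R y \<le> inverse c *\<^sub>R (c *\<^sub>R x)"
      using y(2) c by (intro scaleR_left_mono) auto
    then have "inverse c *\<^sub>R y \<le> x" "0 \<le> inverse c *\<^sub>R y"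
      using c y(1) by (auto intro: scaleR_nonneg_nonneg)
    then have "c *\<^sub>R T (inverse c *\<^sub>R y) \<le> c *\<^sub>R p x"
      using c by (intro scaleR_left_mono upper) auto
    then show "T y \<le> c *\<^sub>R p x"
      using c by (simp add: linear_scale[OF T(1)])
  qed
  have "p 0 = 0"
    using add[of 0 0] by simp
  have scale: "p (c *\<^sub>R x) = c *\<^sub>R p x" if c: "0 \<le> c" and x: "0 \<le> x" for c x
  proof (cases "c = 0")
    case False
    then have c: "0 < c"
      using c by simp
    \<comment> \<open>The reverse inequality is the same one for the inverse scalar.\<close>
    have "p (inverse c *\<^sub>R (c *\<^sub>R x)) \<le> inverse c *\<^sub>R p (c *\<^sub>R x)"
      using c x by (intro scale_le) (auto intro: scaleR_nonneg_nonneg)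
    then have "c *\<^sub>R p x \<le> c *\<^sub>R (inverse c *\<^sub>R p (c *\<^sub>R x))"
      using c by (intro scaleR_left_mono) auto
    then show ?thesis
      using c scale_le[OF c x] by (simp add: order.antisym)
  qed (simp add: \<open>p 0 = 0\<close>)
  obtain P where P: "linear P" "\<And>x. 0 \<le> x \<Longrightarrow> P x = p x"
    by (rule linear_extension_from_cone[of p]) (assumption | rule add scale that)+
  have "positive_operator P"
    unfolding positive_operator_def using P upper[OF order_refl] linear_0[OF T(1)] by simp
  moreover have "positive_operator (\<lambda>x. P x - T x)"
    unfolding positive_operator_def using P upper[OF _ order_refl] linear_compose_sub[OF P(1) T(1)]
    by simp
  ultimately show "T \<in> L_r"
    unfolding L_r_def by (intro CollectI exI[of _ P] exI[of _ "\<lambda>x. P x - T x"]) simp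
qed

section \<open>Coincidence of the four operator classes\<close>

theorem corollary3p1:
  fixes \<tau>\<^sub>1 :: "'a::riesz_space topology" and \<tau>\<^sub>2 :: "'b::riesz_space topology"
  assumes "locally_solid \<tau>\<^sub>1" and "locally_solid \<tau>\<^sub>2"
    and "countable_zero_base \<tau>\<^sub>1
       \<or> ((\<exists>V. zero_nhd \<tau>\<^sub>1 V \<and> convex V \<and> topologically_bounded \<tau>\<^sub>1 V) \<and>
          (\<exists>V. zero_nhd \<tau>\<^sub>2 V \<and> convex V \<and> topologically_bounded \<tau>\<^sub>2 V))
       \<or> ((locally_convex \<tau>\<^sub>1 \<and> Hausdorff_space \<tau>\<^sub>1) \<and>
          (locally_convex \<tau>\<^sub>2 \<and> Hausdorff_space \<tau>\<^sub>2))
       \<or> (bornological \<tau>\<^sub>1 \<and> locally_convex \<tau>\<^sub>2)"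
  shows
    "((\<exists>V. zero_nhd \<tau>\<^sub>1 V \<and> order_bounded V) \<and> (\<exists>V. zero_nhd \<tau>\<^sub>2 V \<and> order_bounded V) \<and>
       dedekind_complete TYPE('b) \<longrightarrow>
       (L_b :: ('a \<Rightarrow> 'b) set) = L_r \<and> (L_r :: ('a \<Rightarrow> 'b) set) = L_tb \<tau>\<^sub>1 \<tau>\<^sub>2 \<and>
       L_tb \<tau>\<^sub>1 \<tau>\<^sub>2 = L_tc \<tau>\<^sub>1 \<tau>\<^sub>2)
     \<and> (\<tau>\<^sub>1 interior_of {x. 0 \<le> x} \<noteq> {} \<and> \<tau>\<^sub>2 interior_of {x. 0 \<le> x} \<noteq> {} \<longrightarrow>
       L_b = L_tb \<tau>\<^sub>1 \<tau>\<^sub>2 \<and> L_tb \<tau>\<^sub>1 \<tau>\<^sub>2 = L_tc \<tau>\<^sub>1 \<tau>\<^sub>2)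
     \<and> (\<tau>\<^sub>1 interior_of {x. 0 \<le> x} \<noteq> {} \<and> \<tau>\<^sub>2 interior_of {x. 0 \<le> x} \<noteq> {} \<and>
       dedekind_complete TYPE('b) \<longrightarrow>
       (L_b :: ('a \<Rightarrow> 'b) set) = L_r \<and> (L_r :: ('a \<Rightarrow> 'b) set) = L_tb \<tau>\<^sub>1 \<tau>\<^sub>2 \<and>
       L_tb \<tau>\<^sub>1 \<tau>\<^sub>2 = L_tc \<tau>\<^sub>1 \<tau>\<^sub>2)"
proof -
  have bounded: "L_b = L_tb \<tau>\<^sub>1 \<tau>\<^sub>2 \<and> L_tb \<tau>\<^sub>1 \<tau>\<^sub>2 = L_tc \<tau>\<^sub>1 \<tau>\<^sub>2"
    if "\<exists>u. zero_nhd \<tau>\<^sub>1 {- u..u}" "\<exists>v. zero_nhd \<tau>\<^sub>2 {- v..v}"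
    using that L_b_eq_L_tb[OF assms(1,2)] L_tb_eq_L_tc[OF assms(1,2)] by blast
  have regular: "(L_b :: ('a \<Rightarrow> 'b) set) = L_r" if "dedekind_complete TYPE('b)"
    using riesz_kantorovich_L_b_subset_L_r[OF that] L_r_subset_L_b by blast
  have cone: "\<exists>u. zero_nhd \<tau>\<^sub>1 {- u..u}" "\<exists>v. zero_nhd \<tau>\<^sub>2 {- v..v}"
    if "\<tau>\<^sub>1 interior_of {x. 0 \<le> x} \<noteq> {}" "\<tau>\<^sub>2 interior_of {x. 0 \<le> x} \<noteq> {}"
    using that assms(1,2) interval_zero_nhd_of_cone_interior by blast+
  show ?thesis
  proof (intro conjI impI; elim conjE exE)
    fix V W
    assume "zero_nhd \<tau>\<^sub>1 V" "order_bounded V" "zero_nhd \<tau>\<^sub>2 W" "order_bounded W"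
      and complete: "dedekind_complete TYPE('b)"
    then have intervals: "\<exists>u. zero_nhd \<tau>\<^sub>1 {- u..u}" "\<exists>v. zero_nhd \<tau>\<^sub>2 {- v..v}"
      using interval_zero_nhd_of_order_bounded by blast+
    show "(L_b :: ('a \<Rightarrow> 'b) set) = L_r"
      by (rule regular[OF complete])
    show "(L_r :: ('a \<Rightarrow> 'b) set) = L_tb \<tau>\<^sub>1 \<tau>\<^sub>2" "L_tb \<tau>\<^sub>1 \<tau>\<^sub>2 = L_tc \<tau>\<^sub>1 \<tau>\<^sub>2"
      using bounded[OF intervals] regular[OF complete] by metis+
  next
    assume interior: "\<tau>\<^sub>1 interior_of {x. 0 \<le> x} \<noteq> {}" "\<tau>\<^sub>2 interior_of {x. 0 \<le> x} \<noteq> {}"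
    show "L_b = L_tb \<tau>\<^sub>1 \<tau>\<^sub>2" "L_tb \<tau>\<^sub>1 \<tau>\<^sub>2 = L_tc \<tau>\<^sub>1 \<tau>\<^sub>2"
      using bounded[OF cone[OF interior]] by metis+
    assume complete: "dedekind_complete TYPE('b)"
    show "(L_b :: ('a \<Rightarrow> 'b) set) = L_r"
      by (rule regular[OF complete])
    show "(L_r :: ('a \<Rightarrow> 'b) set) = L_tb \<tau>\<^sub>1 \<tau>\<^sub>2" "L_tb \<tau>\<^sub>1 \<tau>\<^sub>2 = L_tc \<tau>\<^sub>1 \<tau>\<^sub>2"
      using bounded[OF cone[OF interior]] regular[OF complete] by metis+
  qed
qed

end
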